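(* Fix $\nu>0$ and $\lambda_1,\lambda_2>0$, and let $X\sim\mathrm{CMP}(\lambda_1,\nu)$ and $Y\sim\mathrm{CMP}(\lambda_2,\nu)$ be independent. Then $X+Y\sim\mathrm{CMP}(\lambda_1+\lambda_2,\nu)$ if and only if $X$ and $Y$ are Poisson distributed.
   Context: For $\lambda,\nu>0$, $X\sim\mathrm{CMP}(\lambda,\nu)$ (COM-Poisson distribution) means $P(X=k)=\frac{\lambda^k}{(k!)^\nu}\cdot\frac{1}{Z(\lambda,\nu)}$ for $k=0,1,2,\dots$, where $Z(\lambda,\nu)=\sum_{i=0}^\infty\frac{\lambda^i}{(i!)^\nu}$. *)

theory Defs
  imports "HOL-Probability.Probability"
begin

definition cmp_norm :: "real \<Rightarrow> real \<Rightarrow> real" where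
  "cmp_norm l \<nu> = (\<Sum>i. l ^ i / fact i powr \<nu>)"

text \<open>The COM-Poisson distribution. The embedding is only meaningful for positive parameters;
  see \<open>pmf_cmp\<close> below.\<close>

definition cmp_pmf :: "real \<Rightarrow> real \<Rightarrow> nat pmf" where
  "cmp_pmf l \<nu> = embed_pmf (\<lambda>k. l ^ k / fact k powr \<nu> * (1 / cmp_norm l \<nu>))"

lemma summable_cmp:
  fixes l \<nu> :: real
  assumes "l > 0" "\<nu> > 0"
  shows "summable (\<lambda>k. l ^ k / fact k powr \<nu>)"
proof -
  have "(\<lambda>n. l / real (Suc n) powr \<nu>) \<longlonglongrightarrow> 0"
    using assms by real_asymp
  then have "\<forall>\<^sub>F n in sequentially. l / real (Suc n) powr \<nu> < 1/2"
    by (rule order_tendstoD) simp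
  then obtain N where N: "\<And>n. n \<ge> N \<Longrightarrow> l / real (Suc n) powr \<nu> < 1/2"
    by (auto simp: eventually_sequentially)
  show ?thesis
  proof (rule summable_ratio_test[where c = "1/2" and N = N])
    fix n assume "N \<le> n"
    have "l ^ Suc n / fact (Suc n) powr \<nu> = l / real (Suc n) powr \<nu> * (l ^ n / fact n powr \<nu>)"
      by (simp add: powr_mult del: of_nat_Suc)
    also have "\<dots> \<le> 1/2 * (l ^ n / fact n powr \<nu>)"
      using N[OF \<open>N \<le> n\<close>] assms by (intro mult_right_mono) auto
    finally show "norm (l ^ Suc n / fact (Suc n) powr \<nu>) \<le> 1/2 * norm (l ^ n / fact n powr \<nu>)"
      using assms by simp
  qed simp
qed

lemma cmp_norm_pos:
  assumes "l > 0" "\<nu> > 0"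
  shows "cmp_norm l \<nu> > 0"
  unfolding cmp_norm_def using assms by (intro suminf_pos summable_cmp) auto

lemma pmf_cmp:
  assumes "l > 0" "\<nu> > 0"
  shows "pmf (cmp_pmf l \<nu>) k = l ^ k / fact k powr \<nu> * (1 / cmp_norm l \<nu>)"
  unfolding cmp_pmf_def
proof (rule pmf_embed_pmf)
  let ?f = "\<lambda>k. l ^ k / fact k powr \<nu> * (1 / cmp_norm l \<nu>)"
  note Z = cmp_norm_pos[OF assms]
  show nonneg: "0 \<le> ?f k" for k
    using assms Z by simp
  have "?f sums (cmp_norm l \<nu> * (1 / cmp_norm l \<nu>))"
    unfolding cmp_norm_def by (intro sums_mult2 summable_sums summable_cmp assms)
  then have "?f sums 1"
    using Z by simp
  then have "(\<Sum>k. ennreal (?f k)) = ennreal 1"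
    by (intro suminf_ennreal_eq nonneg)
  then show "(\<integral>\<^sup>+k. ennreal (?f k) \<partial>count_space UNIV) = 1"
    by (simp add: nn_integral_count_space_nat)
qed

end

theory Submission
  imports Defs
begin

text \<open>
  Both sides of the equivalence turn out to say that \<open>\<nu> = 1\<close>.

  The probability of \<open>X + Y = n\<close> is the convolution of the two mass functions, which for
  COM-Poisson laws is a multiple (independent of \<open>n\<close>) of
  \<open>S n / fact n powr \<nu>\<close>, where \<open>S n = (\<Sum>k\<le>n. (n choose k) powr \<nu> * l1 ^ k * l2 ^ (n - k))\<close>
  (\<open>cmp_convolution\<close>).  The target law \<open>CMP(l1 + l2, \<nu>)\<close> has the same form with
  \<open>(l1 + l2) ^ n\<close> in place of \<open>S n\<close>.  So the sum is COM-Poisson with parameter \<open>l1 + l2\<close>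
  exactly if \<open>S n\<close> is proportional to \<open>(l1 + l2) ^ n\<close>.  At \<open>n = 0\<close> both equal \<open>1\<close>, so the
  factor is \<open>1\<close>, and at \<open>n = 2\<close> comparison gives \<open>2 powr \<nu> = 2\<close>, hence \<open>\<nu> = 1\<close>;
  conversely \<open>\<nu> = 1\<close> turns the equations into the binomial theorem
  (\<open>cmp_convolution_eq_cmp_iff\<close>).

  For \<open>\<nu> = 1\<close> the law \<open>CMP(l, \<nu>)\<close> is the Poisson law with mean \<open>l\<close>.  It is Poisson in no
  other case: the ratio of the masses at \<open>1\<close> and \<open>0\<close> forces the mean to be \<open>l\<close>, and then
  the ratio of the masses at \<open>2\<close> and \<open>0\<close> gives \<open>2 powr \<nu> = 2\<close> once more
  (\<open>cmp_pmf_eq_poisson_pmf_iff\<close>).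
\<close>

lemma distr_eq_measure_pmf_iff:
  fixes X :: "'a \<Rightarrow> 'b :: countable"
  assumes "prob_space M" and X: "X \<in> M \<rightarrow>\<^sub>M count_space UNIV"
  shows "distr M (count_space UNIV) X = measure_pmf p \<longleftrightarrow>
    (\<forall>n. measure M (X -` {n} \<inter> space M) = pmf p n)"
proof -
  interpret prob_space M by fact
  have "distr M (count_space UNIV) X = measure_pmf p \<longleftrightarrow>
    (\<forall>n. emeasure (distr M (count_space UNIV) X) {n} = emeasure (measure_pmf p) {n})"
    by (auto intro!: measure_eqI_countable[where A = UNIV])
  also have "\<dots> \<longleftrightarrow> (\<forall>n. measure M (X -` {n} \<inter> space M) = pmf p n)"
    by (simp add: emeasure_distr[OF X] emeasure_pmf_single emeasure_eq_measure)
  finally show ?thesis .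
qed

lemma (in prob_space) prob_add_indep_nat:
  fixes X Y :: "'a \<Rightarrow> nat"
  assumes indep: "indep_var (count_space UNIV) X (count_space UNIV) Y"
  shows "prob ((\<lambda>\<omega>. X \<omega> + Y \<omega>) -` {n} \<inter> space M) =
    (\<Sum>k\<le>n. prob (X -` {k} \<inter> space M) * prob (Y -` {n - k} \<inter> space M))"
proof -
  let ?E = "\<lambda>k. (\<lambda>\<omega>. (X \<omega>, Y \<omega>)) -` ({k} \<times> {n - k}) \<inter> space M"
  note [measurable] = indep_var_rv1[OF indep] indep_var_rv2[OF indep]
  have "?E k = (X -` {k} \<inter> space M) \<inter> (Y -` {n - k} \<inter> space M)" for k
    by auto
  then have E: "?E k \<in> events" for k
    by simp
  have "(\<lambda>\<omega>. X \<omega> + Y \<omega>) -` {n} \<inter> space M = (\<Union>k\<le>n. ?E k)"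
    by auto
  also have "prob \<dots> = (\<Sum>k\<le>n. prob (?E k))"
    using E by (intro finite_measure_finite_Union) (auto simp: disjoint_family_on_def)
  also have "\<dots> = (\<Sum>k\<le>n. prob (X -` {k} \<inter> space M) * prob (Y -` {n - k} \<inter> space M))"
    by (intro sum.cong refl indep_varD[OF indep]) auto
  finally show ?thesis .
qed

lemma eq_1_if_two_powr_eq_2:
  fixes \<nu> :: real
  assumes "2 powr \<nu> = 2"
  shows "\<nu> = 1"
  using assms powr_inj[of 2 \<nu> 1] by simp

lemma cmp_norm_1: "cmp_norm l 1 = exp l"
  by (simp add: cmp_norm_def exp_def field_simps)

lemma cmp_pmf_1_eq_poisson_pmf:
  assumes "l > 0"
  shows "cmp_pmf l 1 = poisson_pmf l"
proof (rule pmf_eqI)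
  show "pmf (cmp_pmf l 1) k = pmf (poisson_pmf l) k" for k
    using assms by (simp add: pmf_cmp cmp_norm_1 exp_minus field_simps)
qed

lemma cmp_pmf_eq_poisson_pmf_iff:
  assumes "l > 0" "\<nu> > 0" "\<mu> > 0"
  shows "cmp_pmf l \<nu> = poisson_pmf \<mu> \<longleftrightarrow> \<nu> = 1 \<and> \<mu> = l"
proof
  assume eq: "cmp_pmf l \<nu> = poisson_pmf \<mu>"
  have *: "l ^ k / fact k powr \<nu> * (1 / cmp_norm l \<nu>) = \<mu> ^ k / fact k * exp (- \<mu>)" for k
    using arg_cong[OF eq, of "\<lambda>p. pmf p k"] assms by (simp add: pmf_cmp)
  have norm: "1 / cmp_norm l \<nu> = exp (- \<mu>)"
    using *[of 0] by simp
  have **: "l ^ k / fact k powr \<nu> = \<mu> ^ k / fact k" for k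
    using *[of k] unfolding norm mult_cancel_right by simp
  have "l = \<mu>"
    using **[of 1] by simp
  moreover have "2 powr \<nu> = 2"
    using **[of 2] assms \<open>l = \<mu>\<close> by (simp add: field_simps fact_2)
  ultimately show "\<nu> = 1 \<and> \<mu> = l"
    using eq_1_if_two_powr_eq_2 by auto
next
  assume "\<nu> = 1 \<and> \<mu> = l"
  then show "cmp_pmf l \<nu> = poisson_pmf \<mu>"
    using assms cmp_pmf_1_eq_poisson_pmf by simp
qed

text \<open>
  The product of the weights \<open>1 / fact k powr \<nu>\<close> and \<open>1 / fact (n - k) powr \<nu>\<close> is
  \<open>(n choose k) powr \<nu> / fact n powr \<nu>\<close>, so the convolution is a binomial sum whose
  coefficients are raised to the power \<open>\<nu>\<close>.
\<close>

lemma cmp_convolution: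
  assumes "l1 > 0" "l2 > 0" "\<nu> > 0"
  shows "(\<Sum>k\<le>n. pmf (cmp_pmf l1 \<nu>) k * pmf (cmp_pmf l2 \<nu>) (n - k)) =
    (\<Sum>k\<le>n. real (n choose k) powr \<nu> * l1 ^ k * l2 ^ (n - k)) / fact n powr \<nu>
      * (1 / (cmp_norm l1 \<nu> * cmp_norm l2 \<nu>))"
proof -
  have "pmf (cmp_pmf l1 \<nu>) k * pmf (cmp_pmf l2 \<nu>) (n - k) =
      real (n choose k) powr \<nu> * l1 ^ k * l2 ^ (n - k) / fact n powr \<nu>
        * (1 / (cmp_norm l1 \<nu> * cmp_norm l2 \<nu>))" if "k \<le> n" for k
  proof -
    have "real (n choose k) powr \<nu> = fact n powr \<nu> / (fact k powr \<nu> * fact (n - k) powr \<nu>)"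
      using that by (simp add: binomial_fact powr_divide powr_mult)
    then show ?thesis
      using assms by (simp add: pmf_cmp)
  qed
  then show ?thesis
    by (simp add: sum_divide_distrib sum_distrib_right)
qed

lemma cmp_convolution_eq_cmp_iff:
  assumes "l1 > 0" "l2 > 0" "\<nu> > 0"
  shows "(\<forall>n. (\<Sum>k\<le>n. pmf (cmp_pmf l1 \<nu>) k * pmf (cmp_pmf l2 \<nu>) (n - k)) =
      pmf (cmp_pmf (l1 + l2) \<nu>) n) \<longleftrightarrow> \<nu> = 1"
proof
  assume "\<forall>n. (\<Sum>k\<le>n. pmf (cmp_pmf l1 \<nu>) k * pmf (cmp_pmf l2 \<nu>) (n - k)) =
      pmf (cmp_pmf (l1 + l2) \<nu>) n"
  then have *: "(\<Sum>k\<le>n. real (n choose k) powr \<nu> * l1 ^ k * l2 ^ (n - k)) / fact n powr \<nu>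
      * (1 / (cmp_norm l1 \<nu> * cmp_norm l2 \<nu>)) =
      (l1 + l2) ^ n / fact n powr \<nu> * (1 / cmp_norm (l1 + l2) \<nu>)" for n
    unfolding cmp_convolution[OF assms] using assms by (simp add: pmf_cmp)
  have norm: "1 / (cmp_norm l1 \<nu> * cmp_norm l2 \<nu>) = 1 / cmp_norm (l1 + l2) \<nu>"
    using *[of 0] by simp
  have "cmp_norm (l1 + l2) \<nu> \<noteq> 0"
    using cmp_norm_pos[of "l1 + l2" \<nu>] assms by simp
  then have "(\<Sum>k\<le>2. real (2 choose k) powr \<nu> * l1 ^ k * l2 ^ (2 - k)) = (l1 + l2) ^ 2"
    using *[of 2] unfolding norm by simp
  then have "2 powr \<nu> * l1 * l2 = 2 * l1 * l2"
    by (simp add: numeral_2_eq_2 power2_eq_square algebra_simps)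
  then show "\<nu> = 1"
    using assms eq_1_if_two_powr_eq_2 by simp
next
  assume [simp]: "\<nu> = 1"
  show "\<forall>n. (\<Sum>k\<le>n. pmf (cmp_pmf l1 \<nu>) k * pmf (cmp_pmf l2 \<nu>) (n - k)) =
      pmf (cmp_pmf (l1 + l2) \<nu>) n"
    unfolding cmp_convolution[OF assms]
    using assms by (simp add: pmf_cmp cmp_norm_1 binomial_ring exp_add)
qed

theorem corollary4p2:
  fixes M :: "'a measure" and X Y :: "'a \<Rightarrow> nat" and \<nu> l1 l2 :: real
  assumes "prob_space M"
    and "\<nu> > 0" and "l1 > 0" and "l2 > 0"
    and "prob_space.indep_var M (count_space UNIV) X (count_space UNIV) Y"
    and "distr M (count_space UNIV) X = measure_pmf (cmp_pmf l1 \<nu>)"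
    and "distr M (count_space UNIV) Y = measure_pmf (cmp_pmf l2 \<nu>)"
  shows "distr M (count_space UNIV) (\<lambda>\<omega>. X \<omega> + Y \<omega>) = measure_pmf (cmp_pmf (l1 + l2) \<nu>)
    \<longleftrightarrow> (\<exists>\<mu>>0. distr M (count_space UNIV) X = measure_pmf (poisson_pmf \<mu>)) \<and>
        (\<exists>\<mu>>0. distr M (count_space UNIV) Y = measure_pmf (poisson_pmf \<mu>))"
proof -
  interpret prob_space M by fact
  note indep = assms(5)
  note [measurable] = indep_var_rv1[OF indep] indep_var_rv2[OF indep]
  have X: "prob (X -` {k} \<inter> space M) = pmf (cmp_pmf l1 \<nu>) k" for k
    using assms(6) by (simp add: distr_eq_measure_pmf_iff[OF assms(1)])
  have Y: "prob (Y -` {k} \<inter> space M) = pmf (cmp_pmf l2 \<nu>) k" for k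
    using assms(7) by (simp add: distr_eq_measure_pmf_iff[OF assms(1)])
  have "distr M (count_space UNIV) (\<lambda>\<omega>. X \<omega> + Y \<omega>) = measure_pmf (cmp_pmf (l1 + l2) \<nu>)
    \<longleftrightarrow> (\<forall>n. prob ((\<lambda>\<omega>. X \<omega> + Y \<omega>) -` {n} \<inter> space M) = pmf (cmp_pmf (l1 + l2) \<nu>) n)"
    by (rule distr_eq_measure_pmf_iff[OF assms(1)]) measurable
  also have "\<dots> \<longleftrightarrow> \<nu> = 1"
    unfolding prob_add_indep_nat[OF indep] X Y
    using assms by (intro cmp_convolution_eq_cmp_iff)
  also have "\<dots> \<longleftrightarrow> (\<exists>\<mu>>0. distr M (count_space UNIV) X = measure_pmf (poisson_pmf \<mu>)) \<and>
        (\<exists>\<mu>>0. distr M (count_space UNIV) Y = measure_pmf (poisson_pmf \<mu>))"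
    unfolding assms(6,7) measure_pmf_inject
    using assms(2-4) by (auto simp: cmp_pmf_eq_poisson_pmf_iff)
  finally show ?thesis .
qed

end
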